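(* Let $X$ be a metric space, and let $\mu$ be an Ahlfors $s$-regular measure on $X$ for some $s\in(0,\infty)$. Let $(Y,\rho)$ be a complete metric space. Let $0\le r\le1$ and $0<q<\infty$ be such that $rq\le s$, and let $u\in B^r_{q,\infty}(X,\mu;Y)$. Then there exists a set $\Theta\subset X$ such that the Hausdorff dimension of $\Theta$ is at most $s-rq$, and every point $x\in X\setminus\Theta$ is a Lebesgue point of $u$, i.e. there exists $u^*(x)\in Y$ such that $$\lim_{\varepsilon\to0^+}\frac1{\mu(B_\varepsilon(x))}\int_{B_\varepsilon(x)}\rho(u(z),u^*(x))^q\,d\mu(z)=0.$$
   Context: $B_t(x)$ denotes the closed ball with center $x$ and radius $t\in(0,\infty)$. A Borel measure on $X$ is a positive outer measure for which all Borel sets are measurable. Ahlfors $s$-regular: a Borel measure $\mu$ on $X$ for which there are constants $c,C>0$ with $c\,t^s\le\mu(B_t(x))\le C\,t^s$ for all $x\in X$ and all $0<t<\operatorname{diam}(X)$. Local integrability: $F\in L^q_{\mathrm{loc}}(X\times X,\mu\times\mu)$ means $F$ is $\mu\times\mu$-measurable and $\int_B|F|^q\,d(\mu\times\mu)<\infty$ for every closed ball $B\subset X\times X$. Besov space: assume $0<\mu(B)<\infty$ for every closed ball $B\subset X$. A $\mu$-measurable function $u:X\to Y$ belongs to $B^r_{q,\infty}(X,\mu;Y)$ iff $F_u(x,z):=\rho(u(x),u(z))$ belongs to $L^q_{\mathrm{loc}}(X\times X,\mu\times\mu)$ and $$\|u\|_{B^r_{q,\infty}(X,\mu;Y)}:=\sup_{t>0}\left(\int_X\frac1{\mu(B_t(x))}\int_{B_t(x)}\frac{\rho(u(x),u(z))^q}{t^{rq}}\,d\mu(z)\,d\mu(x)\right)^{1/q}<\infty.$$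 The Hausdorff dimension of $E\subset X$ is $\inf\{\alpha\ge0:\mathcal H^\alpha(E)=0\}$, where $\mathcal H^\alpha$ is the $\alpha$-dimensional Hausdorff measure (defined with countable covers by sets of diameter at most $\delta$, weights $(\operatorname{diam}E_i)^\alpha$, and $\delta\to0^+$). *)

theory Defs
  imports "HOL-Analysis.Analysis"
begin

section \<open>Borel measures as outer measures\<close>

text \<open>
  A measure is an outer measure defined on all subsets of the space; measurability is meant in the
  sense of Caratheodory. Borel regularity is not part of the definition.
\<close>

definition borel_outer_measure :: "('a::topological_space set \<Rightarrow> ennreal) \<Rightarrow> bool" where
  "borel_outer_measure \<mu> \<longleftrightarrow>
     outer_measure_space (Pow UNIV) \<mu> \<and> sets borel \<subseteq> lambda_system UNIV (Pow UNIV) \<mu>"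

definition caratheodory_measure :: "('a set \<Rightarrow> ennreal) \<Rightarrow> 'a measure" where
  "caratheodory_measure \<mu> = measure_of UNIV (lambda_system UNIV (Pow UNIV) \<mu>) \<mu>"

text \<open>
  The completion makes the measurable sets those of the outer product measure whenever the
  factors are sigma-finite.
\<close>

definition product_square :: "('a set \<Rightarrow> ennreal) \<Rightarrow> ('a \<times> 'a) measure" where
  "product_square \<mu> =
     completion (caratheodory_measure \<mu> \<Otimes>\<^sub>M caratheodory_measure \<mu>)"

definition balls_positive_finite :: "('a::metric_space set \<Rightarrow> ennreal) \<Rightarrow> bool" where
  "balls_positive_finite \<mu> \<longleftrightarrow> (\<forall>x t. 0 < t \<longrightarrow> 0 < \<mu> (cball x t) \<and> \<mu> (cball x t) < \<infinity>)"

section \<open>Diameter and Ahlfors regularity\<close>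

text \<open>The library's real-valued \<open>diameter\<close> has no meaningful value on unbounded sets.\<close>

definition ediameter :: "'a::metric_space set \<Rightarrow> ennreal" where
  "ediameter E = (SUP x\<in>E. SUP y\<in>E. ennreal (dist x y))"

definition ahlfors_regular :: "real \<Rightarrow> ('a::metric_space set \<Rightarrow> ennreal) \<Rightarrow> bool" where
  "ahlfors_regular s \<mu> \<longleftrightarrow> borel_outer_measure \<mu> \<and>
     (\<exists>c>0. \<exists>C>0. \<forall>x t. 0 < t \<and> ennreal t < ediameter (UNIV :: 'a set) \<longrightarrow>
        ennreal (c * t powr s) \<le> \<mu> (cball x t) \<and> \<mu> (cball x t) \<le> ennreal (C * t powr s))"

section \<open>Besov spaces\<close>

text \<open>Powers with exponent \<open>p \<ge> 0\<close>, where \<open>0\<^sup>0 = 1\<close> (the library has \<open>0 powr 0 = 0\<close>).\<close>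

definition ennreal_powr :: "ennreal \<Rightarrow> real \<Rightarrow> ennreal" where
  "ennreal_powr a p =
     (if p = 0 then 1 else if a = \<infinity> then \<infinity> else ennreal (enn2real a powr p))"

text \<open>
  Closed balls in the product are those of the library's metric on pairs, the Euclidean combination
  of the two distances; the maximum or the sum of the distances gives the same spaces.
\<close>

definition Lq_loc :: "real \<Rightarrow> 'c::metric_space measure \<Rightarrow> ('c \<Rightarrow> real) set" where
  "Lq_loc q N = {F. F \<in> borel_measurable N \<and>
     (\<forall>p t. 0 < t \<longrightarrow> (\<integral>\<^sup>+ w \<in> cball p t. ennreal (\<bar>F w\<bar> powr q) \<partial>N) < \<infinity>)}"

definition besov_norm ::
    "real \<Rightarrow> real \<Rightarrow> ('a::metric_space set \<Rightarrow> ennreal) \<Rightarrow> ('a \<Rightarrow> 'b::metric_space) \<Rightarrow> ennreal" where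
  "besov_norm r q \<mu> u =
     (SUP t \<in> {0<..}. ennreal_powr
        (\<integral>\<^sup>+ x. (\<integral>\<^sup>+ z \<in> cball x t. ennreal (dist (u x) (u z) powr q / t powr (r * q))
                   \<partial>caratheodory_measure \<mu>) / \<mu> (cball x t)
           \<partial>caratheodory_measure \<mu>) (1 / q))"

definition besov_space ::
    "real \<Rightarrow> real \<Rightarrow> ('a::metric_space set \<Rightarrow> ennreal) \<Rightarrow> ('a \<Rightarrow> 'b::metric_space) set" where
  "besov_space r q \<mu> =
     {u. u \<in> borel_measurable (caratheodory_measure \<mu>) \<and>
         (\<lambda>(x, z). dist (u x) (u z)) \<in> Lq_loc q (product_square \<mu>) \<and>
         besov_norm r q \<mu> u < \<infinity>}"

section \<open>Hausdorff dimension\<close>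

text \<open>
  Covers are indexed by the natural numbers; empty members have weight 0 for every exponent, so
  finite covers are included. No normalising constant is used.
\<close>

definition hausdorff_content :: "real \<Rightarrow> real \<Rightarrow> 'a::metric_space set \<Rightarrow> ennreal" where
  "hausdorff_content \<alpha> \<delta> E =
     Inf {(\<Sum>i. if A i = {} then 0 else ennreal_powr (ediameter (A i)) \<alpha>) | A :: nat \<Rightarrow> 'a set.
            E \<subseteq> (\<Union>i. A i) \<and> (\<forall>i. ediameter (A i) \<le> ennreal \<delta>)}"

text \<open>The contents increase as \<open>\<delta>\<close> decreases, so the limit as \<open>\<delta> \<rightarrow> 0+\<close> is the supremum.\<close>

definition hausdorff_measure :: "real \<Rightarrow> 'a::metric_space set \<Rightarrow> ennreal" where
  "hausdorff_measure \<alpha> E = (SUP \<delta> \<in> {0<..}. hausdorff_content \<alpha> \<delta> E)"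

definition hausdorff_dimension :: "'a::metric_space set \<Rightarrow> ennreal" where
  "hausdorff_dimension E = Inf {ennreal \<alpha> | \<alpha>. 0 \<le> \<alpha> \<and> hausdorff_measure \<alpha> E = 0}"

section \<open>Lebesgue points\<close>

definition lebesgue_point ::
    "real \<Rightarrow> ('a::metric_space set \<Rightarrow> ennreal) \<Rightarrow> ('a \<Rightarrow> 'b::metric_space) \<Rightarrow> 'a \<Rightarrow> bool" where
  "lebesgue_point q \<mu> u x \<longleftrightarrow>
     (\<exists>y. ((\<lambda>\<epsilon>. (\<integral>\<^sup>+ z \<in> cball x \<epsilon>. ennreal (dist (u z) y powr q) \<partial>caratheodory_measure \<mu>)
               / \<mu> (cball x \<epsilon>)) \<longlongrightarrow> 0) (at_right 0))"

end

theory Submission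
  imports Defs
begin

text \<open>
  At the scale \<open>t = (1/2) ^ j\<close> call \<open>x\<close> bad if for every \<open>y \<in> cball x t\<close> the average of
  \<open>dist (u y) (u z) powr q\<close> over \<open>z \<in> cball x t\<close> is at least \<open>t powr \<epsilon>\<close>. Then the inner Besov
  integrand at scale \<open>2 * t\<close> is bounded below by a multiple of \<open>t powr (\<epsilon> - r * q)\<close> on all of
  \<open>cball x t\<close>, so a \<open>2 * t\<close>-separated set of bad points has at most \<open>K * t powr (r * q - s - \<epsilon>)\<close>
  elements. Covering by balls around a maximal separated set shows that the points that are bad at
  infinitely many scales are null for every Hausdorff measure of exponent above \<open>s - r * q + \<epsilon>\<close>.
  Around any other point almost all scales provide a value \<open>u y\<close> close to \<open>u\<close> on average; these
  values form a Cauchy sequence with geometric rate, whose limit is the Lebesgue value.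
\<close>

section \<open>Outer measures restricted to Borel sets\<close>

text \<open>By Caratheodory's theorem an outer measure is a measure on its lambda system, which
  contains the Borel sets by hypothesis. This lets \<open>\<mu>\<close> and \<open>emeasure\<close>
  be exchanged on balls.\<close>

lemma caratheodory_measure_borel:
  assumes "borel_outer_measure \<mu>" and "A \<in> sets borel"
  shows sets_caratheodory_measure: "A \<in> sets (caratheodory_measure \<mu>)"
    and emeasure_caratheodory_measure: "emeasure (caratheodory_measure \<mu>) A = \<mu> A"
proof -
  let ?L = "lambda_system UNIV (Pow UNIV) \<mu>"
  have A: "A \<in> ?L" and "outer_measure_space (Pow UNIV) \<mu>"
    using assms by (auto simp: borel_outer_measure_def)
  then have "measure_space UNIV ?L \<mu>"
    by (intro sigma_algebra.caratheodory_lemma sigma_algebra_Pow)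
  then have ms: "sigma_algebra UNIV ?L" "positive ?L \<mu>" "countably_additive ?L \<mu>"
    by (auto simp: measure_space_def)
  show "A \<in> sets (caratheodory_measure \<mu>)"
    using A sigma_algebra.sets_measure_of_eq[OF ms(1)] by (simp add: caratheodory_measure_def)
  show "emeasure (caratheodory_measure \<mu>) A = \<mu> A"
    unfolding caratheodory_measure_def by (rule emeasure_measure_of_sigma[OF ms A])
qed

section \<open>Metric estimates and limits\<close>

text \<open>A distance is at most twice the larger of two legs. Going through the maximum instead of
  convexity covers \<open>q < 1\<close> as well.\<close>

lemma dist_powr_triangle:
  fixes a b z :: "'b::metric_space"
  assumes "0 \<le> q"
  shows "dist a b powr q \<le> 2 powr q * (dist a z powr q + dist z b powr q)"
proof -
  let ?m = "max (dist a z) (dist z b)"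
  have "dist a b powr q \<le> (2 * ?m) powr q"
    using dist_triangle[of a b z] assms by (intro powr_mono2) auto
  also have "\<dots> = 2 powr q * ?m powr q" by (simp add: powr_mult)
  also have "?m powr q \<le> dist a z powr q + dist z b powr q" by (simp add: max_def)
  finally show ?thesis by simp
qed

lemma Cauchy_geometric:
  fixes w :: "nat \<Rightarrow> 'b::metric_space"
  assumes \<theta>: "0 < \<theta>" "\<theta> < 1" and K: "0 \<le> K"
    and step: "\<And>j. n0 \<le> j \<Longrightarrow> dist (w j) (w (Suc j)) \<le> K * \<theta> ^ j"
  shows "Cauchy w"
proof -
  \<comment> \<open>The exact finite geometric sum makes the induction close; the bound uniform in
    \<open>k\<close> is read off afterwards.\<close>
  have tail: "dist (w n) (w (n + k)) \<le> K * \<theta> ^ n * (1 - \<theta> ^ k) / (1 - \<theta>)" if n: "n0 \<le> n" for n k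
  proof (induction k)
    case (Suc k)
    have "dist (w n) (w (n + Suc k)) \<le> dist (w n) (w (n + k)) + dist (w (n + k)) (w (Suc (n + k)))"
      by (simp add: dist_triangle)
    also have "\<dots> \<le> K * \<theta> ^ n * (1 - \<theta> ^ k) / (1 - \<theta>) + K * \<theta> ^ (n + k)"
      using Suc step[of "n + k"] n by simp
    also have "\<dots> = K * \<theta> ^ n * (1 - \<theta> ^ Suc k) / (1 - \<theta>)"
      using \<theta> by (simp add: field_simps power_add)
    finally show ?case .
  qed simp
  have bound: "dist (w n) (w m) \<le> K * \<theta> ^ n / (1 - \<theta>)" if "n0 \<le> n" "n \<le> m" for n m
  proof -
    obtain k where m: "m = n + k" using le_Suc_ex[OF \<open>n \<le> m\<close>] by blast
    have "K * \<theta> ^ n * (1 - \<theta> ^ k) \<le> K * \<theta> ^ n * 1"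
      using \<theta> K by (intro mult_left_mono mult_nonneg_nonneg zero_le_power) simp_all
    then have "K * \<theta> ^ n * (1 - \<theta> ^ k) / (1 - \<theta>) \<le> K * \<theta> ^ n / (1 - \<theta>)"
      using \<theta> by (intro divide_right_mono) auto
    with tail[OF that(1), of k] m show ?thesis by simp
  qed
  have "(\<lambda>n. K * \<theta> ^ n / (1 - \<theta>)) \<longlonglongrightarrow> K * 0 / (1 - \<theta>)"
    using \<theta> by (intro tendsto_divide tendsto_mult tendsto_const LIMSEQ_realpow_zero) simp_all
  then have lim: "(\<lambda>n. K * \<theta> ^ n / (1 - \<theta>)) \<longlonglongrightarrow> 0" by simp
  show ?thesis
  proof (rule CauchyI')
    fix e :: real assume "0 < e"
    then have "eventually (\<lambda>n. K * \<theta> ^ n / (1 - \<theta>) < e \<and> n0 \<le> n) sequentially"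
      by (intro eventually_conj order_tendstoD(2)[OF lim] eventually_ge_at_top)
    then obtain N where N: "\<And>n. N \<le> n \<Longrightarrow> K * \<theta> ^ n / (1 - \<theta>) < e \<and> n0 \<le> n"
      unfolding eventually_sequentially by blast
    have "dist (w m) (w n) < e" if "N \<le> m" "m < n" for m n
      using N[OF that(1)] bound[of m n] that(2) by simp
    then show "\<exists>M. \<forall>m\<ge>M. \<forall>n>m. dist (w m) (w n) < e" by blast
  qed
qed

lemma ennreal_tendsto_0I:
  fixes f :: "'c \<Rightarrow> ennreal"
  assumes "\<And>e::real. 0 < e \<Longrightarrow> eventually (\<lambda>x. f x \<le> ennreal e) F"
  shows "(f \<longlongrightarrow> 0) F"
proof (rule order_tendstoI)
  fix a :: ennreal assume "0 < a"
  then obtain b where b: "0 < b" "b < a" using dense by blast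
  then have "b < top" by (metis top_greatest top.not_eq_extremum less_le_not_le)
  with b obtain e where e: "0 < e" "b = ennreal e"
    by (metis ennreal_cases ennreal_less_zero_iff top.not_eq_extremum)
  show "eventually (\<lambda>x. f x < a) F"
    using assms[OF e(1)] by eventually_elim (use b e in auto)
qed simp

text \<open>Every small radius lies between two consecutive powers of 1/2, so a statement about all
  small radii reduces to one about large dyadic indices.\<close>

lemma eventually_dyadic_at_right:
  assumes "eventually P sequentially"
    and "\<And>j t. P j \<Longrightarrow> (1/2) ^ Suc j \<le> t \<Longrightarrow> t \<le> (1/2) ^ j \<Longrightarrow> Q (t::real)"
  shows "eventually Q (at_right 0)"
proof -
  obtain N where N: "\<And>j. N \<le> j \<Longrightarrow> P j" using assms(1) by (auto simp: eventually_sequentially)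
  have "Q t" if t: "0 < t" "t < (1/2) ^ N" for t
  proof -
    obtain n where n: "(1/2) ^ n < t" using real_arch_pow_inv[OF t(1), of "1/2"] by auto
    \<comment> \<open>Minimality gives \<open>t \<le> (1/2) ^ (m - 1)\<close>, so the dyadic
      interval containing \<open>t\<close> has index \<open>j = m - 1\<close>.\<close>
    define m where "m = (LEAST n. (1/2) ^ n < t)"
    have m: "(1/2) ^ m < t" using LeastI[of "\<lambda>n. (1/2) ^ n < t", OF n] by (simp add: m_def)
    have "N < m"
    proof (rule ccontr)
      assume "\<not> N < m"
      then have "(1/2::real) ^ N \<le> (1/2) ^ m" by (intro power_decreasing) auto
      with m t show False by simp
    qed
    then obtain j where j: "m = Suc j" "N \<le> j" by (cases m) auto
    have "\<not> (1/2) ^ j < t" using not_less_Least[of j "\<lambda>n. (1/2) ^ n < t"] j by (simp add: m_def)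
    with m j show ?thesis using assms(2)[OF N[of j], of t] by auto
  qed
  then show ?thesis by (auto simp: eventually_at_right[of 0 1] intro!: exI[of _ "(1/2)^N"])
qed

lemma dist_powr_measurable [measurable]:
  fixes u :: "'a \<Rightarrow> 'b::metric_space"
  assumes [measurable]: "u \<in> borel_measurable M"
  shows "(\<lambda>z. dist a (u z) powr q) \<in> borel_measurable M"
proof -
  have "(\<lambda>b. dist a b) \<in> borel_measurable borel"
    by (intro borel_measurable_continuous_onI continuous_intros)
  then have [measurable]: "(\<lambda>z. dist a (u z)) \<in> borel_measurable M"
    using assms by (rule measurable_compose[rotated])
  show ?thesis by measurable
qed

text \<open>The integrated quasi-triangle inequality in two uses: \<open>?dist\<close> shows that
  two values that are both close to \<open>u\<close> on average over \<open>B\<close> are close to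
  each other, and \<open>?shift\<close> passes from one reference value to another.\<close>

lemma nn_integral_dist_powr_triangle:
  fixes u :: "'a \<Rightarrow> 'b::metric_space"
  assumes [measurable]: "u \<in> borel_measurable M" "B \<in> sets M" and q: "0 \<le> q"
  shows "ennreal (dist a b powr q) * emeasure M B \<le>
           ennreal (2 powr q) * ((\<integral>\<^sup>+ z\<in>B. ennreal (dist a (u z) powr q) \<partial>M) +
             (\<integral>\<^sup>+ z\<in>B. ennreal (dist b (u z) powr q) \<partial>M))" (is ?dist)
    and "(\<integral>\<^sup>+ z\<in>B. ennreal (dist b (u z) powr q) \<partial>M) \<le>
           ennreal (2 powr q) * ((\<integral>\<^sup>+ z\<in>B. ennreal (dist a (u z) powr q) \<partial>M) +
             ennreal (dist a b powr q) * emeasure M B)" (is ?shift)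
proof -
  have "ennreal (dist a b powr q) * emeasure M B =
      (\<integral>\<^sup>+ z\<in>B. ennreal (dist a b powr q) \<partial>M)"
    by (simp add: nn_integral_cmult_indicator)
  also have "\<dots> \<le> (\<integral>\<^sup>+ z. ennreal (2 powr q) * (ennreal (dist a (u z) powr q) * indicator B z +
      ennreal (dist b (u z) powr q) * indicator B z) \<partial>M)"
  proof (rule nn_integral_mono)
    fix z
    have "ennreal (dist a b powr q) \<le>
        ennreal (2 powr q * (dist a (u z) powr q + dist b (u z) powr q))"
      using dist_powr_triangle[OF q, of a b "u z"] by (simp add: dist_commute ennreal_leI)
    then show "ennreal (dist a b powr q) * indicator B z \<le> ennreal (2 powr q) *
        (ennreal (dist a (u z) powr q) * indicator B z + ennreal (dist b (u z) powr q) * indicator B z)"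
      by (auto split: split_indicator simp: ennreal_mult ennreal_plus)
  qed
  finally show ?dist by (simp add: nn_integral_cmult nn_integral_add)
  have "(\<integral>\<^sup>+ z\<in>B. ennreal (dist b (u z) powr q) \<partial>M) \<le>
      (\<integral>\<^sup>+ z. ennreal (2 powr q) * (ennreal (dist a (u z) powr q) * indicator B z +
        ennreal (dist a b powr q) * indicator B z) \<partial>M)"
  proof (rule nn_integral_mono)
    fix z
    have "ennreal (dist b (u z) powr q) \<le>
        ennreal (2 powr q * (dist a (u z) powr q + dist a b powr q))"
      using dist_powr_triangle[OF q, of b "u z" a] by (simp add: dist_commute add.commute ennreal_leI)
    then show "ennreal (dist b (u z) powr q) * indicator B z \<le> ennreal (2 powr q) *
        (ennreal (dist a (u z) powr q) * indicator B z + ennreal (dist a b powr q) * indicator B z)"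
      by (auto split: split_indicator simp: ennreal_mult ennreal_plus)
  qed
  then show ?shift by (simp add: nn_integral_cmult nn_integral_add nn_integral_cmult_indicator)
qed

section \<open>Lebesgue points from geometric decay of the mean oscillation\<close>

text \<open>Reference values at consecutive scales are both close to \<open>u\<close> on the smaller
  ball, where doubling controls the average of the coarser one. Hence they differ by a geometrically
  small amount and converge by completeness. Shifting to the limit \<open>y\<close> costs only
  \<open>dist (w j) y powr q\<close>, which tends to 0.\<close>

lemma lebesgue_point_of_decay:
  fixes u :: "'a::metric_space \<Rightarrow> 'b::complete_space"
  assumes \<mu>: "borel_outer_measure \<mu>" "balls_positive_finite \<mu>"
    and u: "u \<in> borel_measurable (caratheodory_measure \<mu>)"
    and q: "0 < q" and p: "0 < p" "p < 1" and \<Lambda>: "0 \<le> \<Lambda>"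
    and doubling: "\<And>j. n0 \<le> j \<Longrightarrow>
      \<mu> (cball x ((1/2) ^ j)) \<le> ennreal \<Lambda> * \<mu> (cball x ((1/2) ^ Suc j))"
    and decay: "\<And>j. n0 \<le> j \<Longrightarrow> \<exists>a.
      (\<integral>\<^sup>+ z\<in>cball x ((1/2) ^ j). ennreal (dist a (u z) powr q) \<partial>caratheodory_measure \<mu>)
        \<le> ennreal (p ^ j) * \<mu> (cball x ((1/2) ^ j))"
  shows "lebesgue_point q \<mu> u x"
proof -
  define M where "M = caratheodory_measure \<mu>"
  define B where "B j = cball x ((1/2::real) ^ j)" for j
  have cball[measurable]: "cball y t \<in> sets M" and em: "emeasure M (cball y t) = \<mu> (cball y t)"
    for y t
    using caratheodory_measure_borel[OF \<mu>(1)] by (auto simp: M_def)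
  have [measurable]: "B j \<in> sets M" for j by (simp add: B_def)
  have emB: "emeasure M (B j) = \<mu> (B j)" for j by (simp add: B_def em)
  note u[folded M_def, measurable]
  have fin: "0 < \<mu> (cball y t)" "\<mu> (cball y t) < top" if "0 < t" for y t
    using \<mu>(2) that by (auto simp: balls_positive_finite_def)
  have Bfin: "\<mu> (B j) \<noteq> 0" "\<mu> (B j) \<noteq> top" for j
    using fin[of "(1/2) ^ j" x] by (auto simp: B_def)
  have doubling': "\<mu> (B j) \<le> ennreal \<Lambda> * \<mu> (B (Suc j))" if "n0 \<le> j" for j
    using doubling[OF that] by (simp add: B_def)
  define I where "I a j = (\<integral>\<^sup>+ z\<in>B j. ennreal (dist a (u z) powr q) \<partial>M)" for a j
  obtain w where w: "\<And>j. n0 \<le> j \<Longrightarrow> I (w j) j \<le> ennreal (p ^ j) * \<mu> (B j)"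
    using decay unfolding I_def B_def M_def by metis
  \<comment> \<open>\<open>\<Lambda>\<close> pays for carrying the estimate at \<open>w j\<close>
    from \<open>B j\<close> down to \<open>B (Suc j)\<close>; the 1 belongs to
    \<open>w (Suc j)\<close>, which already lives on that ball.\<close>
  define K where "K = 2 powr q * (\<Lambda> + 1)"
  have K: "0 \<le> K" using \<Lambda> by (simp add: K_def)
  have step: "dist (w j) (w (Suc j)) \<le> K powr (1/q) * (p powr (1/q)) ^ j" if j: "n0 \<le> j" for j
  proof -
    let ?d = "dist (w j) (w (Suc j))"
    have "B (Suc j) \<subseteq> B j"
      unfolding B_def by (intro subset_cball power_decreasing) auto
    then have I1: "I (w j) (Suc j) \<le> I (w j) j" unfolding I_def
      by (intro nn_integral_mono) (auto split: split_indicator)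
    have "ennreal (?d powr q) * \<mu> (B (Suc j)) \<le>
        ennreal (2 powr q) * (I (w j) (Suc j) + I (w (Suc j)) (Suc j))"
      using nn_integral_dist_powr_triangle(1)[of u M "B (Suc j)" q "w j" "w (Suc j)"] q
      by (simp add: I_def emB)
    also have "\<dots> \<le> ennreal (2 powr q) *
        (ennreal (p ^ j) * (ennreal \<Lambda> * \<mu> (B (Suc j))) + ennreal (p ^ j) * \<mu> (B (Suc j)))"
    proof (intro mult_left_mono add_mono)
      show "I (w j) (Suc j) \<le> ennreal (p ^ j) * (ennreal \<Lambda> * \<mu> (B (Suc j)))"
        using I1 w[OF j] mult_left_mono[OF doubling'[OF j], of "ennreal (p ^ j)"] by (meson order_trans zero_le)
      have "ennreal (p ^ Suc j) \<le> ennreal (p ^ j)"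
        using p by (intro ennreal_leI power_decreasing) auto
      then show "I (w (Suc j)) (Suc j) \<le> ennreal (p ^ j) * \<mu> (B (Suc j))"
        using w[of "Suc j"] j by (meson order_trans le_SucI mult_right_mono zero_le)
    qed simp
    also have "\<dots> = ennreal (K * p ^ j) * \<mu> (B (Suc j))"
      using p \<Lambda> by (simp add: K_def ennreal_mult ennreal_plus field_simps)
    \<comment> \<open>The common factor \<open>\<mu> (B (Suc j))\<close> may be cancelled because it
      is neither 0 nor infinite.\<close>
    finally have "ennreal (?d powr q) \<le> ennreal (K * p ^ j)"
      using Bfin[of "Suc j"] ennreal_mult_le_mult_iff by (metis mult.commute)
    then have "?d powr q \<le> K * p ^ j" using K p by simp
    then have "(?d powr q) powr (1/q) \<le> (K * p ^ j) powr (1/q)"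
      using q by (intro powr_mono2) auto
    then show ?thesis
      using q p K by (simp add: powr_powr powr_mult powr_power powr_realpow[symmetric] mult.commute)
  qed
  have "p powr (1/q) < 1" using powr_less_mono2[of "1/q" p 1] p q by simp
  then have "Cauchy w"
    using step p by (intro Cauchy_geometric[of "p powr (1/q)" "K powr (1/q)" n0]) auto
  then obtain y where y: "w \<longlonglongrightarrow> y" using Cauchy_convergent convergent_def by blast
  \<comment> \<open>For a radius between two dyadic ones the integral is enlarged to
    \<open>B j\<close> while the denominator is only bounded below by the mass of
    \<open>B (Suc j)\<close>. The factor \<open>\<Lambda>\<close> accounts for this
    mismatch.\<close>
  define \<eta> where "\<eta> j = 2 powr q * (p ^ j + dist (w j) y powr q) * \<Lambda>" for j
  have "(\<lambda>j. dist (w j) y) \<longlonglongrightarrow> 0" using y tendsto_dist_iff by blast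
  then have "(\<lambda>j. dist (w j) y powr q) \<longlonglongrightarrow> 0 powr q"
    using q by (intro tendsto_powr') auto
  then have "\<eta> \<longlonglongrightarrow> 2 powr q * (0 + 0 powr q) * \<Lambda>"
    unfolding \<eta>_def using p by (intro tendsto_mult tendsto_const tendsto_add LIMSEQ_realpow_zero) auto
  then have \<eta>: "\<eta> \<longlonglongrightarrow> 0" by simp
  have I_y: "I y j \<le> ennreal (\<eta> j) * \<mu> (B (Suc j))" if j: "n0 \<le> j" for j
  proof -
    have "I y j \<le> ennreal (2 powr q) * (I (w j) j + ennreal (dist (w j) y powr q) * \<mu> (B j))"
      using nn_integral_dist_powr_triangle(2)[of u M "B j" q y "w j"] q
      by (simp add: I_def emB)
    also have "\<dots> \<le> ennreal (2 powr q) *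
        (ennreal (p ^ j) * \<mu> (B j) + ennreal (dist (w j) y powr q) * \<mu> (B j))"
      using w[OF j] by (intro mult_left_mono add_mono) auto
    also have "\<dots> = ennreal (2 powr q * (p ^ j + dist (w j) y powr q)) * \<mu> (B j)"
      using p by (simp add: ennreal_mult ennreal_plus field_simps)
    also have "\<dots> \<le> ennreal (2 powr q * (p ^ j + dist (w j) y powr q)) * (ennreal \<Lambda> * \<mu> (B (Suc j)))"
      using doubling'[OF j] by (intro mult_left_mono) auto
    also have "\<dots> = ennreal (\<eta> j) * \<mu> (B (Suc j))"
      using p \<Lambda> by (simp add: \<eta>_def ennreal_mult mult.assoc)
    finally show ?thesis .
  qed
  have "((\<lambda>\<epsilon>. (\<integral>\<^sup>+ z\<in>cball x \<epsilon>. ennreal (dist (u z) y powr q) \<partial>M) / \<mu> (cball x \<epsilon>)) \<longlongrightarrow> 0)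
      (at_right 0)"
  proof (rule ennreal_tendsto_0I)
    fix e :: real assume e: "0 < e"
    have "eventually (\<lambda>j. \<eta> j < e \<and> n0 \<le> j) sequentially"
      using e by (intro eventually_conj order_tendstoD(2)[OF \<eta>] eventually_ge_at_top)
    then show "\<forall>\<^sub>F \<epsilon> in at_right 0.
        (\<integral>\<^sup>+ z\<in>cball x \<epsilon>. ennreal (dist (u z) y powr q) \<partial>M) / \<mu> (cball x \<epsilon>) \<le> ennreal e"
    proof (rule eventually_dyadic_at_right)
      fix j and t :: real assume j: "\<eta> j < e \<and> n0 \<le> j" and t: "(1/2) ^ Suc j \<le> t" "t \<le> (1/2) ^ j"
      have "0 < t" using t(1) zero_less_power[of "1/2::real" "Suc j"] by linarith
      have "(\<integral>\<^sup>+ z\<in>cball x t. ennreal (dist (u z) y powr q) \<partial>M) \<le> I y j"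
        unfolding I_def using t(2)
        by (intro nn_integral_mono) (auto split: split_indicator simp: B_def dist_commute)
      also have "\<dots> \<le> ennreal (\<eta> j) * \<mu> (B (Suc j))" using I_y j by simp
      also have "\<dots> \<le> ennreal e * \<mu> (cball x t)"
      proof (intro mult_mono ennreal_leI)
        have "emeasure M (B (Suc j)) \<le> emeasure M (cball x t)"
          using t(1) by (intro emeasure_mono) (auto simp: B_def)
        then show "\<mu> (B (Suc j)) \<le> \<mu> (cball x t)" by (simp add: emB em)
      qed (use j in auto)
      finally show "(\<integral>\<^sup>+ z\<in>cball x t. ennreal (dist (u z) y powr q) \<partial>M) / \<mu> (cball x t) \<le> ennreal e"
        using fin[OF \<open>0 < t\<close>] by (intro divide_le_posI_ennreal) (auto simp: mult.commute)
    qed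
  qed
  then show ?thesis unfolding lebesgue_point_def M_def by blast
qed

section \<open>Separated sets, ball covers and Hausdorff measure\<close>

text \<open>A separated set of largest cardinality exists thanks to the uniform bound. A point
  outside all its balls could be added to it, contradicting maximality.\<close>

lemma maximal_separated_set:
  fixes E :: "'a::metric_space set"
  assumes d: "0 \<le> d"
    and bound: "\<And>S. finite S \<Longrightarrow> S \<subseteq> E \<Longrightarrow> pairwise (\<lambda>x y. d < dist x y) S \<Longrightarrow> card S \<le> N"
  obtains S where "finite S" "S \<subseteq> E" "pairwise (\<lambda>x y. d < dist x y) S" "E \<subseteq> (\<Union>x\<in>S. cball x d)"
proof -
  let ?P = "\<lambda>S. finite S \<and> S \<subseteq> E \<and> pairwise (\<lambda>x y. d < dist x y) S"
  have "\<exists>S. ?P S \<and> (\<forall>T. ?P T \<longrightarrow> card T \<le> card S)"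
    by (rule ex_has_greatest_nat[of ?P "{}" card "Suc N"]) (auto simp: bound less_Suc_eq_le)
  then obtain S where S: "?P S" and max: "\<And>T. ?P T \<Longrightarrow> card T \<le> card S" by blast
  have "E \<subseteq> (\<Union>x\<in>S. cball x d)"
  proof (rule ccontr)
    assume "\<not> E \<subseteq> (\<Union>x\<in>S. cball x d)"
    then obtain y where y: "y \<in> E" "\<forall>x\<in>S. d < dist x y" by (auto simp: subset_eq not_le)
    then have "y \<notin> S" using d by force
    have "?P (insert y S)" using S y by (auto simp: pairwise_insert dist_commute)
    from max[OF this] show False using S \<open>y \<notin> S\<close> by simp
  qed
  with S that show ?thesis by blast
qed

lemma ediameter_cball_le: "0 \<le> t \<Longrightarrow> ediameter (cball x t) \<le> ennreal (2 * t)"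
  unfolding ediameter_def
proof (intro SUP_least ennreal_leI)
  fix y z assume "y \<in> cball x t" "z \<in> cball x t"
  then show "dist y z \<le> 2 * t" using dist_triangle2[of y z x] by (simp add: dist_commute)
qed

lemma ennreal_powr_le:
  assumes "a \<le> ennreal b" "0 \<le> b" "0 < p"
  shows "ennreal_powr a p \<le> ennreal (b powr p)"
proof -
  have "a \<noteq> top" using assms(1) by (auto simp: top_unique)
  then obtain a' where a: "a = ennreal a'" "0 \<le> a'" by (cases a) auto
  then show ?thesis using assms by (auto simp: ennreal_powr_def intro!: ennreal_leI powr_mono2)
qed

text \<open>Finitely many balls at each of countably many scales form one countable cover, and each
  ball weighs at most the power of its doubled radius.\<close>

lemma hausdorff_content_le_ball_cover:
  fixes \<Theta> :: "'a::metric_space set"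
  assumes \<alpha>: "0 < \<alpha>" and fin: "\<And>j. finite (S j)"
    and cover: "\<And>x. x \<in> \<Theta> \<Longrightarrow> \<exists>j. \<exists>y\<in>S j. x \<in> cball y (\<rho> j)"
    and \<rho>: "\<And>j. 0 \<le> \<rho> j" "\<And>j. 2 * \<rho> j \<le> \<delta>"
  shows "hausdorff_content \<alpha> \<delta> \<Theta> \<le> (\<Sum>j. ennreal (real (card (S j)) * (2 * \<rho> j) powr \<alpha>))"
proof -
  have "\<exists>e. \<forall>j. bij_betw (e j) {0..<card (S j)} (S j)"
    using ex_bij_betw_nat_finite[OF fin] by metis
  then obtain e where e: "\<And>j. bij_betw (e j) {0..<card (S j)} (S j)" by blast
  \<comment> \<open>Each finite layer is padded by empty sets, which have weight 0, so that all
    layers become one sequence through \<open>prod_decode\<close>.\<close>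
  define A where "A p = (case p of (j, i) \<Rightarrow> if i < card (S j) then cball (e j i) (\<rho> j) else {})" for p
  define wt where "wt D = (if D = {} then 0 else ennreal_powr (ediameter D) \<alpha>)" for D :: "'a set"
  have diam: "ediameter (A p) \<le> ennreal \<delta>" for p
  proof -
    have "ediameter (A (j, i)) \<le> ennreal (2 * \<rho> j)" for j i
      using ediameter_cball_le[OF \<rho>(1)] by (auto simp: A_def ediameter_def[of "{}"] bot_ennreal)
    then show ?thesis using \<rho>(2) by (cases p) (meson ennreal_leI order_trans)
  qed
  have "\<Theta> \<subseteq> (\<Union>n. A (prod_decode n))"
  proof
    fix x assume "x \<in> \<Theta>"
    then obtain j y where y: "y \<in> S j" "x \<in> cball y (\<rho> j)" using cover by blast
    then obtain i where i: "i < card (S j)" "y = e j i"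
      using bij_betw_imp_surj_on[OF e[of j]] by (metis atLeastLessThan_iff imageE)
    have "x \<in> A (prod_decode (prod_encode (j, i)))" using y i by (simp add: A_def)
    then show "x \<in> (\<Union>n. A (prod_decode n))" by blast
  qed
  then have "hausdorff_content \<alpha> \<delta> \<Theta> \<le> (\<Sum>n. wt (A (prod_decode n)))"
    unfolding hausdorff_content_def wt_def using diam
    by (intro Inf_lower CollectI exI[of _ "\<lambda>n. A (prod_decode n)"]) auto
  also have "\<dots> = (\<Sum>j. \<Sum>i. wt (A (j, i)))"
    by (rule suminf_ennreal_2dimen) simp
  also have "\<dots> \<le> (\<Sum>j. ennreal (real (card (S j)) * (2 * \<rho> j) powr \<alpha>))"
  proof (intro suminf_le summableI)
    fix j
    have "(\<Sum>i. wt (A (j, i))) = (\<Sum>i<card (S j). wt (A (j, i)))"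
      by (intro suminf_finite) (auto simp: A_def wt_def)
    also have "\<dots> \<le> (\<Sum>i<card (S j). ennreal ((2 * \<rho> j) powr \<alpha>))"
      using \<rho>(1) \<alpha> by (intro sum_mono) (auto simp: A_def wt_def intro!: ennreal_powr_le ediameter_cball_le)
    also have "\<dots> = ennreal (real (card (S j)) * (2 * \<rho> j) powr \<alpha>)"
      by (simp add: ennreal_mult ennreal_of_nat_eq_real_of_nat)
    finally show "(\<Sum>i. wt (A (j, i))) \<le> ennreal (real (card (S j)) * (2 * \<rho> j) powr \<alpha>)" .
  qed
  finally show ?thesis .
qed

text \<open>A Borel-Cantelli argument: points covered at infinitely many scales are covered by the
  layers from any index \<open>n\<close> on, and the total weight of these is the tail of a
  convergent geometric series.\<close>

lemma hausdorff_measure_limsup_eq_0: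
  fixes \<Theta> :: "'a::metric_space set"
  assumes \<alpha>: "0 < \<alpha>" and fin: "\<And>j. n0 \<le> j \<Longrightarrow> finite (S j)"
    and cover: "\<And>x. x \<in> \<Theta> \<Longrightarrow> \<exists>\<^sub>\<infinity>j. \<exists>y\<in>S j. x \<in> cball y (2 * (1/2) ^ j)"
    and card: "\<And>j. n0 \<le> j \<Longrightarrow> real (card (S j)) * (4 * (1/2) ^ j) powr \<alpha> \<le> K * \<kappa> ^ j"
    and \<kappa>: "0 < \<kappa>" "\<kappa> < 1" and K: "0 \<le> K"
  shows "hausdorff_measure \<alpha> \<Theta> = 0"
proof -
  have "hausdorff_content \<alpha> \<delta> \<Theta> \<le> 0" if \<delta>: "0 < \<delta>" for \<delta>
  proof (rule ennreal_le_epsilon)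
    fix e :: real assume e: "0 < e"
    have "(\<lambda>n. 4 * (1/2::real) ^ n) \<longlonglongrightarrow> 4 * 0"
      by (intro tendsto_mult tendsto_const LIMSEQ_realpow_zero) auto
    then have l1: "(\<lambda>n. 4 * (1/2::real) ^ n) \<longlonglongrightarrow> 0" by simp
    have "(\<lambda>n. K * \<kappa> ^ n / (1 - \<kappa>)) \<longlonglongrightarrow> K * 0 / (1 - \<kappa>)"
      using \<kappa> by (intro tendsto_divide tendsto_mult tendsto_const LIMSEQ_realpow_zero) simp_all
    then have l2: "(\<lambda>n. K * \<kappa> ^ n / (1 - \<kappa>)) \<longlonglongrightarrow> 0" by simp
    \<comment> \<open>The three conditions make the diameters admissible for
      \<open>\<delta>\<close>, the tail of the weights smaller than \<open>e\<close>, and all layers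
      used finite.\<close>
    have "eventually (\<lambda>n. 4 * (1/2) ^ n < \<delta> \<and> K * \<kappa> ^ n / (1 - \<kappa>) < e \<and> n0 \<le> n) sequentially"
      using e \<delta> by (intro eventually_conj order_tendstoD(2)[OF l1] order_tendstoD(2)[OF l2]
        eventually_ge_at_top)
    then obtain n where n: "4 * (1/2) ^ n < \<delta>" "K * \<kappa> ^ n / (1 - \<kappa>) < e" "n0 \<le> n"
      by (metis (no_types, lifting) eventually_sequentially order_refl)
    define S' where "S' j = S (j + n)" for j
    define \<rho> where "\<rho> j = 2 * (1/2::real) ^ (j + n)" for j
    have "hausdorff_content \<alpha> \<delta> \<Theta> \<le> (\<Sum>j. ennreal (real (card (S' j)) * (2 * \<rho> j) powr \<alpha>))"
    proof (rule hausdorff_content_le_ball_cover[OF \<alpha>])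
      fix x assume "x \<in> \<Theta>"
      then obtain j where j: "n \<le> j" "\<exists>y\<in>S j. x \<in> cball y (2 * (1/2) ^ j)"
        using cover unfolding INFM_nat_le by blast
      then have "\<exists>y\<in>S' (j - n). x \<in> cball y (\<rho> (j - n))" by (simp add: S'_def \<rho>_def)
      then show "\<exists>j. \<exists>y\<in>S' j. x \<in> cball y (\<rho> j)" by blast
    next
      fix j
      have "(1/2::real) ^ (j + n) \<le> (1/2) ^ n" by (intro power_decreasing) auto
      then show "2 * \<rho> j \<le> \<delta>" unfolding \<rho>_def using n(1) by linarith
    qed (use fin n in \<open>auto simp: S'_def \<rho>_def\<close>)
    also have "\<dots> \<le> (\<Sum>j. ennreal (K * \<kappa> ^ n * \<kappa> ^ j))"
    proof (intro suminf_le summableI ennreal_leI)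
      fix j
      show "real (card (S' j)) * (2 * \<rho> j) powr \<alpha> \<le> K * \<kappa> ^ n * \<kappa> ^ j"
        using card[of "j + n"] n(3) by (simp add: S'_def \<rho>_def power_add mult_ac)
    qed
    also have "\<dots> = ennreal (K * \<kappa> ^ n * (1 / (1 - \<kappa>)))"
      using \<kappa> K by (intro suminf_ennreal_eq sums_mult geometric_sums) auto
    also have "\<dots> \<le> ennreal e" using n(2) by (intro ennreal_leI) simp
    finally show "hausdorff_content \<alpha> \<delta> \<Theta> \<le> 0 + ennreal e" by simp
  qed
  then show ?thesis by (simp add: hausdorff_measure_def SUP_eq_iff)
qed

section \<open>Besov energy and packing of oscillating points\<close>

lemma ennreal_inverse_antimono: "a \<le> b \<Longrightarrow> inverse b \<le> inverse (a::ennreal)"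
  including ennreal.lifting
  by transfer (rule ereal_inverse_antimono)

text \<open>Undoing the root of order \<open>q\<close> turns the finite supremum into one real bound
  for the energies at all scales, with \<open>L\<close> the \<open>q\<close>-th power of the
  norm.\<close>

lemma besov_norm_integral_bound:
  assumes "besov_norm r q \<mu> u < \<infinity>" and q: "0 < q"
  obtains L where "0 \<le> L" "\<And>t. 0 < t \<Longrightarrow>
    (\<integral>\<^sup>+ x. (\<integral>\<^sup>+ z \<in> cball x t. ennreal (dist (u x) (u z) powr q / t powr (r * q))
       \<partial>caratheodory_measure \<mu>) / \<mu> (cball x t) \<partial>caratheodory_measure \<mu>) \<le> ennreal L"
proof -
  define I where "I t = (\<integral>\<^sup>+ x. (\<integral>\<^sup>+ z \<in> cball x t.
    ennreal (dist (u x) (u z) powr q / t powr (r * q)) \<partial>caratheodory_measure \<mu>) / \<mu> (cball x t)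
    \<partial>caratheodory_measure \<mu>)" for t
  obtain l where l: "0 \<le> l" "besov_norm r q \<mu> u = ennreal l"
    using assms(1) by (cases "besov_norm r q \<mu> u") auto
  have "I t \<le> ennreal (l powr q)" if "0 < t" for t
  proof -
    have le: "ennreal_powr (I t) (1/q) \<le> ennreal l"
      unfolding l(2)[symmetric] besov_norm_def I_def using that by (intro SUP_upper) auto
    then have "I t \<noteq> top" using q by (auto simp: ennreal_powr_def top_unique)
    then obtain i where i: "0 \<le> i" "I t = ennreal i" by (cases "I t") auto
    have "i powr (1/q) \<le> l" using le q l(1) i by (simp add: ennreal_powr_def)
    then have "(i powr (1/q)) powr q \<le> l powr q" using q by (intro powr_mono2) auto
    then show ?thesis using q i by (simp add: powr_powr ennreal_leI)
  qed
  then show ?thesis using that[of "l powr q"] by (simp add: I_def)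
qed

text \<open>If \<open>y\<close> is within \<open>t\<close> of a centre \<open>x\<close>, then
  \<open>cball y (2 * t)\<close> contains \<open>cball x t\<close>, so the oscillation about
  \<open>u y\<close> on the small ball bounds the energy density at \<open>y\<close> from below. The
  balls of radius \<open>t\<close> around the separated centres are disjoint, so these contributions
  add up to at most \<open>L\<close>.\<close>

lemma oscillating_packing_card_le:
  fixes u :: "'a::metric_space \<Rightarrow> 'b::metric_space"
  assumes \<mu>: "borel_outer_measure \<mu>" and u: "u \<in> borel_measurable (caratheodory_measure \<mu>)"
    and c: "0 < c" and C: "0 < C" and t: "0 < t" and b: "0 \<le> b" and L: "0 \<le> L"
    and lower: "\<And>x. ennreal (c * t powr s) \<le> \<mu> (cball x t)"
    and upper: "\<And>x. \<mu> (cball x (2 * t)) \<le> ennreal (C * (2 * t) powr s)"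
    and energy: "(\<integral>\<^sup>+ x. (\<integral>\<^sup>+ z \<in> cball x (2 * t).
        ennreal (dist (u x) (u z) powr q / (2 * t) powr (r * q)) \<partial>caratheodory_measure \<mu>)
        / \<mu> (cball x (2 * t)) \<partial>caratheodory_measure \<mu>) \<le> ennreal L"
    and S: "finite S" "pairwise (\<lambda>x y. 2 * t < dist x y) S"
    and oscillating: "\<And>x y. x \<in> S \<Longrightarrow> y \<in> cball x t \<Longrightarrow> ennreal b * \<mu> (cball x t) \<le>
        (\<integral>\<^sup>+ z \<in> cball x t. ennreal (dist (u y) (u z) powr q) \<partial>caratheodory_measure \<mu>)"
  shows "real (card S) * (b * c\<^sup>2 * t powr (s - r * q)) \<le> L * C * 2 powr (s + r * q)"
proof -
  define M where "M = caratheodory_measure \<mu>"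
  have cball[measurable]: "cball y t \<in> sets M" and em: "emeasure M (cball y t) = \<mu> (cball y t)"
    for y t
    using caratheodory_measure_borel[OF \<mu>] by (auto simp: M_def)
  note u[folded M_def, measurable]
  define g where "g x = (\<integral>\<^sup>+ z \<in> cball x (2 * t).
        ennreal (dist (u x) (u z) powr q / (2 * t) powr (r * q)) \<partial>M) / \<mu> (cball x (2 * t))" for x
  define U where "U = (\<Union>x\<in>S. cball x t)"
  \<comment> \<open>The pointwise lower bound for \<open>g\<close>: oscillation times the least mass
    of a ball of radius \<open>t\<close>, divided by the Besov weight and by the greatest mass of a
    ball of radius \<open>2 * t\<close>.\<close>
  define k where "k = b * (c * t powr s) / (2 * t) powr (r * q) / (C * (2 * t) powr s)"
  have k: "0 \<le> k" using b c C by (simp add: k_def)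
  have g: "ennreal k \<le> g y" if xy: "x \<in> S" "y \<in> cball x t" for x y
  proof -
    have sub: "cball x t \<subseteq> cball y (2 * t)"
    proof
      fix z assume "z \<in> cball x t"
      then show "z \<in> cball y (2 * t)" using xy(2) dist_triangle2[of y z x]
        by (simp add: dist_commute)
    qed
    have "ennreal (b * (c * t powr s) / (2 * t) powr (r * q))
        = ennreal (1 / (2 * t) powr (r * q)) * (ennreal b * ennreal (c * t powr s))"
      using b c by (simp add: ennreal_mult[symmetric])
    also have "\<dots> \<le> ennreal (1 / (2 * t) powr (r * q)) *
        (\<integral>\<^sup>+ z \<in> cball x t. ennreal (dist (u y) (u z) powr q) \<partial>M)"
      using lower[of x] oscillating[OF xy]
      by (intro mult_left_mono) (auto simp: M_def intro: order_trans[OF mult_left_mono])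
    also have "\<dots> = (\<integral>\<^sup>+ z. ennreal (1 / (2 * t) powr (r * q)) *
        (ennreal (dist (u y) (u z) powr q) * indicator (cball x t) z) \<partial>M)"
      by (simp add: nn_integral_cmult)
    also have "\<dots> \<le> (\<integral>\<^sup>+ z \<in> cball y (2 * t).
        ennreal (dist (u y) (u z) powr q / (2 * t) powr (r * q)) \<partial>M)"
      using sub by (intro nn_integral_mono) (auto split: split_indicator simp: ennreal_mult[symmetric])
    finally have "ennreal (b * (c * t powr s) / (2 * t) powr (r * q)) / ennreal (C * (2 * t) powr s)
        \<le> g y"
      unfolding g_def using upper[of y] by (simp add: divide_ennreal_def mult_mono ennreal_inverse_antimono)
    then show ?thesis using b c C t by (simp add: k_def divide_ennreal)
  qed
  have "disjoint_family_on (\<lambda>x. cball x t) S"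
    unfolding disjoint_family_on_def
  proof (intro ballI impI equals0I)
    fix x y z assume "x \<in> S" "y \<in> S" "x \<noteq> y" "z \<in> cball x t \<inter> cball y t"
    then have "2 * t < dist x y" "dist x z \<le> t" "dist y z \<le> t"
      using S(2) by (auto simp: pairwise_def)
    then show False using dist_triangle2[of x y z] by simp
  qed
  then have "(\<Sum>x\<in>S. \<mu> (cball x t)) = emeasure M U"
    unfolding U_def em[symmetric] using S(1) by (intro sum_emeasure) auto
  moreover have "(\<Sum>x\<in>S. ennreal (c * t powr s)) \<le> (\<Sum>x\<in>S. \<mu> (cball x t))"
    by (intro sum_mono lower)
  ultimately have "ennreal (real (card S) * (c * t powr s)) \<le> emeasure M U"
    using c by (simp add: ennreal_mult ennreal_of_nat_eq_real_of_nat)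
  then have "ennreal (k * (real (card S) * (c * t powr s))) \<le> ennreal k * emeasure M U"
    using k c by (subst ennreal_mult) (auto intro: mult_left_mono)
  also have "\<dots> = (\<integral>\<^sup>+ y. ennreal k * indicator U y \<partial>M)"
    using S(1) by (subst nn_integral_cmult_indicator) (auto simp: U_def)
  also have "\<dots> \<le> (\<integral>\<^sup>+ y. g y \<partial>M)"
    using g by (intro nn_integral_mono) (auto split: split_indicator simp: U_def)
  also have "\<dots> \<le> ennreal L" using energy by (simp add: g_def M_def)
  finally have "k * (real (card S) * (c * t powr s)) \<le> L" using L by simp
  then have "k * (real (card S) * (c * t powr s)) * (C * 2 powr (s + r * q)) \<le>
      L * (C * 2 powr (s + r * q))"
    using C by (intro mult_right_mono) auto
  \<comment> \<open>The \<open>t powr s\<close> in the numerator of \<open>k\<close> cancels against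
    the mass of the doubled ball; the one from the disjoint balls survives and combines with the
    Besov weight to \<open>t powr (s - r * q)\<close>.\<close>
  also have "k * (real (card S) * (c * t powr s)) * (C * 2 powr (s + r * q))
      = real (card S) * (b * c\<^sup>2 * t powr (s - r * q))"
    using C t by (simp add: k_def powr_mult powr_add powr_diff power2_eq_square field_simps)
  finally show ?thesis by (simp add: mult.assoc)
qed

section \<open>The exceptional set and its dimension\<close>

text \<open>The strict gap between \<open>\<alpha>\<close> and \<open>s - r * q\<close> leaves room
  for both a decaying oscillation threshold and a summable cover of the points exceeding it.\<close>

lemma besov_non_lebesgue_points_null:
  fixes u :: "'a::metric_space \<Rightarrow> 'b::complete_space"
  assumes reg: "ahlfors_regular s \<mu>" and pos: "balls_positive_finite \<mu>"
    and q: "0 < q" and rq: "r * q \<le> s" and besov: "u \<in> besov_space r q \<mu>"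
    and \<alpha>: "s - r * q < \<alpha>"
  shows "hausdorff_measure \<alpha> {x. \<not> lebesgue_point q \<mu> u x} = 0"
proof (cases "ediameter (UNIV :: 'a set) = 0")
  \<comment> \<open>Diameter 0 means a one-point space, where regularity gives no information about
    any radius. There \<open>u\<close> is constant, the exceptional set is empty, and empty layers
    cover it.\<close>
  case True
  have "x = y" for x y :: 'a
  proof -
    have "ennreal (dist x y) \<le> ediameter (UNIV :: 'a set)"
      unfolding ediameter_def by (intro SUP_upper2[of x] SUP_upper2[of y]) auto
    with True show ?thesis by (simp add: ennreal_eq_0_iff)
  qed
  then have u: "dist (u z) (u x) = 0" for x z by (metis dist_self)
  have "lebesgue_point q \<mu> u x" for x
    unfolding lebesgue_point_def by (intro exI[of _ "u x"]) (simp add: u)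
  then show ?thesis
    using \<alpha> rq by (intro hausdorff_measure_limsup_eq_0[of \<alpha> 0 "\<lambda>_. {}" _ 0 "1/2"]) auto
next
  case False
  have \<mu>: "borel_outer_measure \<mu>" using reg by (simp add: ahlfors_regular_def)
  define M where "M = caratheodory_measure \<mu>"
  have u: "u \<in> borel_measurable M" using besov by (simp add: besov_space_def M_def)
  obtain c C where c: "0 < c" and C: "0 < C"
    and ball: "\<And>x t. 0 < t \<Longrightarrow> ennreal t < ediameter (UNIV :: 'a set) \<Longrightarrow>
        ennreal (c * t powr s) \<le> \<mu> (cball x t) \<and> \<mu> (cball x t) \<le> ennreal (C * t powr s)"
    using reg unfolding ahlfors_regular_def by blast
  obtain L where L: "0 \<le> L" and energy: "\<And>t. 0 < t \<Longrightarrow>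
    (\<integral>\<^sup>+ x. (\<integral>\<^sup>+ z \<in> cball x t. ennreal (dist (u x) (u z) powr q / t powr (r * q))
       \<partial>caratheodory_measure \<mu>) / \<mu> (cball x t) \<partial>caratheodory_measure \<mu>) \<le> ennreal L"
    using besov q besov_norm_integral_bound[of r q \<mu> u] unfolding besov_space_def by auto
  \<comment> \<open>Any value strictly between 0 and the diameter is finite, so a real scale
    \<open>d\<close> is available for bounded and unbounded spaces alike.\<close>
  obtain D where D: "0 < D" "D < ediameter (UNIV :: 'a set)"
    using False dense[of 0 "ediameter (UNIV :: 'a set)"] by (auto simp: zero_less_iff_neq_zero)
  then obtain d where d: "0 < d" "D = ennreal d"
    by (cases D) auto
  \<comment> \<open>Halving \<open>d\<close> keeps the doubled radius \<open>2 * t j\<close> in the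
    range of regularity too.\<close>
  obtain n0 where n0: "(1/2) ^ n0 < d / 2"
    using real_arch_pow_inv[of "d/2" "1/2"] d by auto
  define t where "t j = (1/2::real) ^ j" for j
  have t: "0 < t j" "t j powr a = ((1/2) powr a) ^ j" "t (Suc j) = t j / 2" for j a
    by (simp_all add: t_def powr_power powr_realpow[symmetric] powr_powr mult.commute)
  have t_small: "2 * t j < d" if "n0 \<le> j" for j
  proof -
    have "t j \<le> (1/2) ^ n0" unfolding t_def using that by (intro power_decreasing) auto
    with n0 show ?thesis by simp
  qed
  have reg_ball: "ennreal (c * \<tau> powr s) \<le> \<mu> (cball x \<tau>)" "\<mu> (cball x \<tau>) \<le> ennreal (C * \<tau> powr s)"
    if "0 < \<tau>" "\<tau> < d" for \<tau> x
  proof -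
    have "ennreal \<tau> < ediameter (UNIV :: 'a set)"
      using ennreal_lessI[OF d(1) that(2)] D(2) d(2) by (metis less_trans)
    then show "ennreal (c * \<tau> powr s) \<le> \<mu> (cball x \<tau>)" "\<mu> (cball x \<tau>) \<le> ennreal (C * \<tau> powr s)"
      using ball[OF that(1)] by auto
  qed
  \<comment> \<open>Half of the gap is spent on the oscillation threshold
    \<open>p ^ j = t j powr \<epsilon>\<close>, the other half makes the cover summable.\<close>
  define \<epsilon> where "\<epsilon> = (\<alpha> - (s - r * q)) / 2"
  have \<epsilon>: "0 < \<epsilon>" using \<alpha> by (simp add: \<epsilon>_def)
  define p where "p = (1/2::real) powr \<epsilon>"
  have p: "0 < p" "p < 1" using powr_less_mono2[of \<epsilon> "1/2" 1] \<epsilon> by (auto simp: p_def)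
  \<comment> \<open>All \<open>y\<close> in the ball are required to oscillate, so that the energy
    is large on the whole ball; a point outside \<open>E j\<close> still has one good value
    \<open>u y\<close>.\<close>
  define E where "E j = {x. \<forall>y\<in>cball x (t j). ennreal (p ^ j) * \<mu> (cball x (t j)) \<le>
      (\<integral>\<^sup>+ z \<in> cball x (t j). ennreal (dist (u y) (u z) powr q) \<partial>M)}" for j
  define H where "H = L * C * 2 powr (s + r * q) / c\<^sup>2"
  have H: "0 \<le> H" using L C by (simp add: H_def)
  have packing: "real (card S) * (p ^ j * t j powr (s - r * q)) \<le> H"
    if j: "n0 \<le> j" and S: "finite S" "S \<subseteq> E j" "pairwise (\<lambda>x y. 2 * t j < dist x y) S" for j S
  proof -
    have "real (card S) * (p ^ j * c\<^sup>2 * t j powr (s - r * q)) \<le> L * C * 2 powr (s + r * q)"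
    proof (rule oscillating_packing_card_le[OF \<mu> u[unfolded M_def] c C t(1) _ L _ _ energy S(1,3)])
      show "ennreal (c * t j powr s) \<le> \<mu> (cball x (t j))" for x
        using t(1)[of j] t_small[OF j] by (intro reg_ball) auto
      show "\<mu> (cball x (2 * t j)) \<le> ennreal (C * (2 * t j) powr s)" for x
        using t(1)[of j] t_small[OF j] by (intro reg_ball) auto
      show "0 < 2 * t j" using t(1) by simp
      show "ennreal (p ^ j) * \<mu> (cball x (t j)) \<le>
        (\<integral>\<^sup>+ z \<in> cball x (t j). ennreal (dist (u y) (u z) powr q) \<partial>caratheodory_measure \<mu>)"
        if "x \<in> S" "y \<in> cball x (t j)" for x y
        using that S(2) by (auto simp: E_def M_def)
    qed (use p in auto)
    then show ?thesis using c by (simp add: H_def field_simps)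
  qed
  have "\<exists>S. finite S \<and> S \<subseteq> E j \<and> pairwise (\<lambda>x y. 2 * t j < dist x y) S \<and>
      E j \<subseteq> (\<Union>x\<in>S. cball x (2 * t j))" if j: "n0 \<le> j" for j
  proof -
    \<comment> \<open>The packing estimate bounds the cardinality at a fixed scale, which is what
      the existence of a finite maximal separated set requires.\<close>
    have "card S \<le> nat \<lfloor>H / (p ^ j * t j powr (s - r * q))\<rfloor>"
      if "finite S" "S \<subseteq> E j" "pairwise (\<lambda>x y. 2 * t j < dist x y) S" for S
    proof -
      have "real (card S) \<le> H / (p ^ j * t j powr (s - r * q))"
        using packing[OF j that] p(1) t(1)[of j] by (simp add: pos_le_divide_eq)
      then show ?thesis by (simp add: le_nat_floor)
    qed
    then show ?thesis
      using maximal_separated_set[of "2 * t j" "E j"] t(1)[of j]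
      by (metis less_eq_real_def zero_le_mult_iff zero_le_numeral)
  qed
  then obtain S where S: "\<And>j. n0 \<le> j \<Longrightarrow> finite (S j)" "\<And>j. n0 \<le> j \<Longrightarrow> S j \<subseteq> E j"
      "\<And>j. n0 \<le> j \<Longrightarrow> pairwise (\<lambda>x y. 2 * t j < dist x y) (S j)"
      "\<And>j. n0 \<le> j \<Longrightarrow> E j \<subseteq> (\<Union>x\<in>S j. cball x (2 * t j))"
    by metis
  show ?thesis
  proof (rule hausdorff_measure_limsup_eq_0)
    show "0 < \<alpha>" using \<alpha> rq by simp
    show "finite (S j)" if "n0 \<le> j" for j using S(1) that .
    show "\<exists>\<^sub>\<infinity>j. \<exists>y\<in>S j. x \<in> cball y (2 * (1/2) ^ j)" if x: "x \<in> {x. \<not> lebesgue_point q \<mu> u x}" for x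
    proof (rule ccontr)
      assume "\<not> ?thesis"
      then obtain n1 where n1: "\<And>j. n1 \<le> j \<Longrightarrow> \<not> (\<exists>y\<in>S j. x \<in> cball y (2 * t j))"
        unfolding INFM_nat_le t_def by blast
      have "lebesgue_point q \<mu> u x"
      proof (rule lebesgue_point_of_decay[OF \<mu> pos u[unfolded M_def] q p])
        \<comment> \<open>The doubling constant is the upper regularity bound at radius
          \<open>t j\<close> over the lower one at half that radius.\<close>
        show "0 \<le> C * 2 powr s / c" using c C by simp
      next
        fix j assume j: "max n0 n1 \<le> j"
        have "\<mu> (cball x (t j)) \<le> ennreal (C * t j powr s)"
          using j t(1)[of j] t_small[of j] by (intro reg_ball) auto
        also have "C * t j powr s = C * 2 powr s / c * (c * t (Suc j) powr s)"
          using c t(1)[of j] by (simp add: t(3) powr_divide)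
        also have "ennreal \<dots> = ennreal (C * 2 powr s / c) * ennreal (c * t (Suc j) powr s)"
          using c C by (intro ennreal_mult) auto
        also have "\<dots> \<le> ennreal (C * 2 powr s / c) * \<mu> (cball x (t (Suc j)))"
          using t(1)[of "Suc j"] t_small[of "Suc j"] j by (intro mult_left_mono reg_ball) auto
        finally show "\<mu> (cball x ((1/2) ^ j)) \<le> ennreal (C * 2 powr s / c) * \<mu> (cball x ((1/2) ^ Suc j))"
          by (simp only: t_def)
        \<comment> \<open>The balls around \<open>S j\<close> cover \<open>E j\<close>, so a point
          missed by them is not in \<open>E j\<close>, and the negated definition supplies the
          reference value.\<close>
        have "x \<notin> E j" using n1[of j] S(4)[of j] j by auto
        then show "\<exists>a. (\<integral>\<^sup>+ z\<in>cball x ((1/2) ^ j). ennreal (dist a (u z) powr q) \<partial>caratheodory_measure \<mu>)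
            \<le> ennreal (p ^ j) * \<mu> (cball x ((1/2) ^ j))"
          unfolding E_def t_def M_def by (auto simp: not_le intro: less_imp_le)
      qed
      with x show False by simp
    qed
    let ?K = "H * 4 powr \<alpha>" and ?\<kappa> = "(1/2::real) powr \<epsilon>"
    show "0 < ?\<kappa>" "?\<kappa> < 1" "0 \<le> ?K" using p H by (auto simp: p_def)
    show "real (card (S j)) * (4 * (1/2) ^ j) powr \<alpha> \<le> ?K * ?\<kappa> ^ j" if j: "n0 \<le> j" for j
    proof -
      \<comment> \<open>One \<open>\<epsilon>\<close> joins \<open>s - r * q\<close> to match the
        packing estimate; the other produces the ratio \<open>?\<kappa>\<close>.\<close>
      have "\<alpha> = \<epsilon> + (s - r * q) + \<epsilon>" by (simp add: \<epsilon>_def)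
      then have "(4 * t j) powr \<alpha> = 4 powr \<alpha> * (t j powr \<epsilon> * t j powr (s - r * q) * t j powr \<epsilon>)"
        using t(1)[of j] by (simp only: powr_mult powr_add mult_ac)
      also have "\<dots> = (p ^ j * t j powr (s - r * q)) * (4 powr \<alpha> * ?\<kappa> ^ j)"
        by (simp add: t(2)[of j \<epsilon>] p_def)
      finally have "real (card (S j)) * (4 * t j) powr \<alpha> =
          real (card (S j)) * (p ^ j * t j powr (s - r * q)) * (4 powr \<alpha> * ?\<kappa> ^ j)"
        by simp
      also have "\<dots> \<le> H * (4 powr \<alpha> * ?\<kappa> ^ j)"
        using packing[OF j S(1-3)[OF j]] by (intro mult_right_mono) auto
      finally show ?thesis by (simp add: t_def mult.assoc)
    qed
  qed
qed

theorem theorem1p7: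
  fixes \<mu> :: "'a::metric_space set \<Rightarrow> ennreal"
    and u :: "'a \<Rightarrow> 'b::complete_space"
    and s r q :: real
  assumes "0 < s"
    and "ahlfors_regular s \<mu>"
    and "balls_positive_finite \<mu>"
    and "0 \<le> r" and "r \<le> 1"
    and "0 < q"
    and "r * q \<le> s"
    and "u \<in> besov_space r q \<mu>"
  shows "\<exists>\<Theta>. hausdorff_dimension \<Theta> \<le> ennreal (s - r * q) \<and>
           (\<forall>x. x \<notin> \<Theta> \<longrightarrow> lebesgue_point q \<mu> u x)"
proof (intro exI conjI)
  let ?\<Theta> = "{x. \<not> lebesgue_point q \<mu> u x}"
  show "hausdorff_dimension ?\<Theta> \<le> ennreal (s - r * q)"
  \<comment> \<open>Nullity is known only for exponents strictly above \<open>s - r * q\<close>,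
    hence the passage to the infimum through an arbitrary \<open>e\<close>.\<close>
  proof (rule ennreal_le_epsilon)
    fix e :: real assume "0 < e"
    then have "hausdorff_measure (s - r * q + e) ?\<Theta> = 0"
      using assms by (intro besov_non_lebesgue_points_null) auto
    then have "hausdorff_dimension ?\<Theta> \<le> ennreal (s - r * q + e)"
      unfolding hausdorff_dimension_def using \<open>0 < e\<close> \<open>r * q \<le> s\<close> by (intro Inf_lower CollectI exI[of _ "s - r * q + e"]) auto
    also have "\<dots> = ennreal (s - r * q) + ennreal e"
      using \<open>0 < e\<close> \<open>r * q \<le> s\<close> by (intro ennreal_plus) auto
    finally show "hausdorff_dimension ?\<Theta> \<le> ennreal (s - r * q) + ennreal e" .
  qed
qed auto

end
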